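(* For all integers $q \geq 2$ and $t \geq 2$, \[\tilde{r}_q (K_{t,t}) \leq 48\, q^{t+2}\, t^{3-1/q} \,(\log_q t)^{1/q}.\]
   Context: For a natural number $q$ and a graph $G$, the $q$-colour on-line Ramsey number $\tilde{r}_q(G)$ is defined via the following game between Builder and Painter, played on an initially edgeless graph with an unlimited supply of vertices: in each round Builder draws a new edge, and Painter immediately colours it with one of $q$ colours. Builder wins once the coloured graph contains a monochromatic copy of $G$. $\tilde{r}_q(G)$ is the minimum number of edges Builder must draw to guarantee a win, regardless of Painter's strategy. $K_{t,t}$ is the complete bipartite graph with $t$ vertices in each part. *)

theory Defs
  imports Complex_Main "HOL-Library.Extended_Real"
begin

(* A graph is a pair (vertex set, set of two-element edges). *)
type_synonym 'a graph = "'a set \<times> 'a set set"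

definition complete_bipartite :: "nat \<Rightarrow> nat \<Rightarrow> (nat + nat) graph" where
  "complete_bipartite m n =
     ({..<m} <+> {..<n}, {{Inl i, Inr j} | i j. i < m \<and> j < n})"

(* The record of a game: the edges drawn so far, each with the colour it received,
   most recent first.  The unlimited supply of vertices is nat. *)
type_synonym history = "(nat set \<times> nat) list"

type_synonym builder = "history \<Rightarrow> nat set"

type_synonym painter = "history \<Rightarrow> nat set \<Rightarrow> nat"

definition builder_strategy :: "builder \<Rightarrow> bool" where
  "builder_strategy \<beta> \<longleftrightarrow> (\<forall>h. card (\<beta> h) = 2 \<and> \<beta> h \<notin> fst ` set h)"

definition painter_strategy :: "nat \<Rightarrow> painter \<Rightarrow> bool" where
  "painter_strategy q \<pi> \<longleftrightarrow> (\<forall>h e. \<pi> h e < q)"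

primrec play :: "builder \<Rightarrow> painter \<Rightarrow> nat \<Rightarrow> history" where
  "play \<beta> \<pi> 0 = []"
| "play \<beta> \<pi> (Suc n) =
     (let h = play \<beta> \<pi> n; e = \<beta> h in (e, \<pi> h e) # h)"

(* Copies are subgraphs, not necessarily induced. *)
definition has_mono_copy :: "'a graph \<Rightarrow> history \<Rightarrow> bool" where
  "has_mono_copy G h \<longleftrightarrow>
     (\<exists>c f. inj_on f (fst G) \<and> (\<forall>e \<in> snd G. (f ` e, c) \<in> set h))"

definition builder_can_win :: "nat \<Rightarrow> 'a graph \<Rightarrow> nat \<Rightarrow> bool" where
  "builder_can_win q G N \<longleftrightarrow>
     (\<exists>\<beta>. builder_strategy \<beta> \<and>
        (\<forall>\<pi>. painter_strategy q \<pi> \<longrightarrow> (\<exists>n\<le>N. has_mono_copy G (play \<beta> \<pi> n))))"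

(* Valued in enat so that the infimum is infinite, rather than an arbitrary number,
   in case Builder cannot force a win within any bounded number of rounds. *)
definition online_ramsey :: "nat \<Rightarrow> 'a graph \<Rightarrow> enat" where
  "online_ramsey q G = Inf (enat ` {N. builder_can_win q G N})"

end

theory Submission imports Defs begin

text \<open>
  Write \<open>L = log\<^sub>q t\<close> and \<open>z = t / L\<close>. If \<open>z \<le> (9 q)\<^sup>q\<close>, Builder draws a complete bipartite graph
  with parts \<open>2 q t\<^sup>2\<close> and \<open>2 q\<^sup>t t\<close>, and the Kovari-Sos-Turan count in a majority colour gives \<open>K\<^sub>t\<^sub>,\<^sub>t\<close>.
  Otherwise Builder first forces, by the same count, a monochromatic biclique with parts
  \<open>S\<close>, \<open>T\<close> of sizes \<open>t - r\<close> and \<open>2 q t\<^sup>2\<close>, where \<open>r\<close> is about \<open>2 L\<close>, and then joins about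
  \<open>27 q\<^sup>t t z powr (- 1 / q)\<close> new vertices to \<open>T\<close>. Let \<open>\<eta> = (1 - 1 / q) ln z / t\<close>. If the colour of the first
  biclique has density at least \<open>(1 - \<eta>) / q\<close> here, then \<open>r\<close> new vertices have \<open>t\<close> common neighbours
  in that colour, and together with \<open>S\<close> they form one side of \<open>K\<^sub>t\<^sub>,\<^sub>t\<close>. If not, some other colour has
  density at least \<open>(1 + \<eta> / (q - 1)) / q\<close>, which is enough for a copy of \<open>K\<^sub>t\<^sub>,\<^sub>t\<close> among the new
  edges alone. The value of \<open>\<eta>\<close> balances the two cases.
\<close>

section \<open>Forcing positions in the game\<close>

text \<open>Backward induction on the game tree, with Builder's moves existential and Painter's
  replies universal. Strategies can thus be composed stage by stage, without a function on all
  histories. Exactly \<open>k\<close> further rounds are played.\<close>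

fun forces :: "nat \<Rightarrow> (history \<Rightarrow> bool) \<Rightarrow> history \<Rightarrow> nat \<Rightarrow> bool" where
  "forces q P h 0 \<longleftrightarrow> P h"
| "forces q P h (Suc k) \<longleftrightarrow>
     (\<exists>e. card e = 2 \<and> e \<notin> fst ` set h \<and> (\<forall>c<q. forces q P ((e, c) # h) k))"

lemma ex_fresh_edge:
  fixes h :: history
  shows "\<exists>e. card e = 2 \<and> e \<notin> fst ` set h"
proof (rule ccontr)
  assume "\<nexists>e. card e = 2 \<and> e \<notin> fst ` set h"
  then have "range (\<lambda>n. {0, Suc n}) \<subseteq> fst ` set h"
    by (auto simp: card_insert_if)
  moreover have "infinite (range (\<lambda>n. {0, Suc n}))"
    by (rule range_inj_infinite) (auto simp: inj_on_def doubleton_eq_iff)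
  ultimately show False
    by (meson finite_set finite_imageI finite_subset)
qed

lemma length_play [simp]: "length (play \<beta> \<pi> n) = n"
  by (induction n) (auto simp: Let_def)

lemma builder_can_win_if_forces:
  assumes "forces q (has_mono_copy G) [] N"
  shows "builder_can_win q G N"
proof -
  \<comment> \<open>The number of rounds left is recovered from the length of the history, so the
    choice of edge depends on the history alone.\<close>
  define good where "good h e \<longleftrightarrow> card e = 2 \<and> e \<notin> fst ` set h \<and>
    (\<forall>c<q. forces q (has_mono_copy G) ((e, c) # h) (N - Suc (length h)))" for h :: history and e
  \<comment> \<open>A strategy must answer every history; off the winning plan it draws an arbitrary
    fresh edge.\<close>
  define \<beta> where "\<beta> h = (if \<exists>e. good h e then SOME e. good h e
    else SOME e. card e = 2 \<and> e \<notin> fst ` set h)" for h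
  have good: "good h (\<beta> h)" if "\<exists>e. good h e" for h
    using someI_ex[OF that] that by (simp add: \<beta>_def)
  have "card (\<beta> h) = 2 \<and> \<beta> h \<notin> fst ` set h" for h
  proof (cases "\<exists>e. good h e")
    case True
    then show ?thesis using good[OF True] by (simp add: good_def)
  next
    case False
    then show ?thesis using someI_ex[OF ex_fresh_edge[of h]] by (simp add: \<beta>_def)
  qed
  then have "builder_strategy \<beta>"
    by (simp add: builder_strategy_def)
  moreover have "has_mono_copy G (play \<beta> \<pi> N)" if \<pi>: "painter_strategy q \<pi>" for \<pi>
  proof -
    have "n \<le> N \<Longrightarrow> forces q (has_mono_copy G) (play \<beta> \<pi> n) (N - n)" for n
    proof (induction n)
      case 0
      then show ?case using assms by simp
    next
      case (Suc n)
      define h where "h = play \<beta> \<pi> n"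
      have "N - n = Suc (N - Suc n)" using Suc.prems by simp
      with Suc have "forces q (has_mono_copy G) h (Suc (N - Suc n))"
        by (simp add: h_def)
      then have "\<exists>e. good h e"
        by (auto simp: good_def h_def)
      then have "good h (\<beta> h)" by (rule good)
      then show ?case
        using \<pi> by (simp add: good_def h_def Let_def painter_strategy_def)
    qed
    from this[of N] show ?thesis by simp
  qed
  ultimately show ?thesis
    unfolding builder_can_win_def by blast
qed

text \<open>The edges of \<open>E\<close> are drawn one by one in any order. The continuation sees
  the later history only through its set, which hides that order and turns Painter's successive
  replies into one colouring of \<open>E\<close>.\<close>

lemma forces_edges:
  assumes "finite E"
    and "\<And>e. e \<in> E \<Longrightarrow> card e = 2"
    and "E \<inter> fst ` set h = {}"
    and "\<And>h'. set h \<subseteq> set h' \<Longrightarrow> fst ` set h' = fst ` set h \<union> E \<Longrightarrow>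
           (\<And>e. e \<in> E \<Longrightarrow> \<exists>c<q. (e, c) \<in> set h') \<Longrightarrow> forces q P h' k"
  shows "forces q P h (card E + k)"
  using assms
proof (induction E arbitrary: h rule: finite_induct)
  case empty
  then show ?case by simp
next
  case (insert e E)
  have "forces q P ((e, c) # h) (card E + k)" if "c < q" for c
  proof (rule insert.IH)
    fix h'
    assume h': "set ((e, c) # h) \<subseteq> set h'" "fst ` set h' = fst ` set ((e, c) # h) \<union> E"
      "\<And>e. e \<in> E \<Longrightarrow> \<exists>c<q. (e, c) \<in> set h'"
    show "forces q P h' k"
      by (rule insert.prems(3)) (use h' \<open>c < q\<close> in auto)
  qed (use insert in auto)
  moreover have "card e = 2" "e \<notin> fst ` set h" using insert.prems by auto
  ultimately show ?case using insert.hyps by auto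
qed

text \<open>One stage of Builder's play. Every new edge meets \<open>A\<close>, so it is fresh once
  no earlier edge does; the bound on where the edges of \<open>h'\<close> lie lets the next stage
  verify the same condition.\<close>

lemma forces_biclique:
  fixes A B :: "nat set"
  assumes "finite A" "finite B" "A \<inter> B = {}"
    and fresh: "\<And>e. e \<in> fst ` set h \<Longrightarrow> e \<inter> A = {}"
    and step: "\<And>h' \<kappa>. set h \<subseteq> set h' \<Longrightarrow> (\<And>e. e \<in> fst ` set h' \<Longrightarrow> e \<in> fst ` set h \<or> e \<subseteq> A \<union> B) \<Longrightarrow>
      (\<And>a b. a \<in> A \<Longrightarrow> b \<in> B \<Longrightarrow> \<kappa> a b < q \<and> ({a, b}, \<kappa> a b) \<in> set h') \<Longrightarrow> forces q P h' k"
  shows "forces q P h (card A * card B + k)"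
proof -
  define E where "E = (\<lambda>(a, b). {a, b}) ` (A \<times> B)"
  have "inj_on (\<lambda>(a, b). {a, b}) (A \<times> B)"
    using assms(3) by (auto simp: inj_on_def doubleton_eq_iff)
  then have card: "card E = card A * card B"
    by (simp add: E_def card_image card_cartesian_product)
  have "forces q P h (card E + k)"
  proof (rule forces_edges)
    show "finite E" using assms by (simp add: E_def)
    show "card e = 2" if "e \<in> E" for e
      using that assms(3) by (auto simp: E_def card_insert_if)
    show "E \<inter> fst ` set h = {}" using fresh by (fastforce simp: E_def)
  next
    fix h'
    assume h': "set h \<subseteq> set h'" "fst ` set h' = fst ` set h \<union> E"
      "\<And>e. e \<in> E \<Longrightarrow> \<exists>c<q. (e, c) \<in> set h'"
    from h'(3) obtain f where f: "\<And>e. e \<in> E \<Longrightarrow> f e < q \<and> (e, f e) \<in> set h'"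
      by metis
    show "forces q P h' k"
    proof (rule step[of h' "\<lambda>a b. f {a, b}"])
      show "f {a, b} < q \<and> ({a, b}, f {a, b}) \<in> set h'" if "a \<in> A" "b \<in> B" for a b
        using f[of "{a, b}"] that by (auto simp: E_def)
      show "e \<in> fst ` set h \<or> e \<subseteq> A \<union> B" if "e \<in> fst ` set h'" for e
        using that h'(2) by (auto simp: E_def)
    qed (use h'(1) in auto)
  qed
  then show ?thesis by (simp add: card)
qed

lemma has_mono_copy_complete_bipartite:
  assumes "card X = t" "card Y = t" "finite X" "finite Y" "X \<inter> Y = {}"
    and "\<And>x y. x \<in> X \<Longrightarrow> y \<in> Y \<Longrightarrow> ({x, y}, c) \<in> set h"
  shows "has_mono_copy (complete_bipartite t t) h"
proof -
  obtain f g where f: "bij_betw f {..<t} X" and g: "bij_betw g {..<t} Y"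
    using assms ex_bij_betw_nat_finite by (metis atLeast0LessThan)
  have "inj_on (case_sum f g) ({..<t} <+> {..<t})"
  proof (rule inj_onI)
    fix u v
    assume "u \<in> {..<t} <+> {..<t}" "v \<in> {..<t} <+> {..<t}" "case_sum f g u = case_sum f g v"
    moreover have "f i \<noteq> g j" "g j \<noteq> f i" if "i < t" "j < t" for i j
      using bij_betwE[OF f] bij_betwE[OF g] assms(5) that by (metis disjoint_iff lessThan_iff)+
    ultimately show "u = v"
      by (cases u; cases v)
        (auto dest: inj_onD[OF bij_betw_imp_inj_on[OF f]] inj_onD[OF bij_betw_imp_inj_on[OF g]])
  qed
  moreover have "(case_sum f g ` e, c) \<in> set h"
    if "e \<in> {{Inl i, Inr j} | i j. i < t \<and> j < t}" for e
    using that bij_betwE[OF f] bij_betwE[OF g] assms(6) by auto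
  ultimately show ?thesis
    unfolding has_mono_copy_def complete_bipartite_def fst_conv snd_conv by blast
qed

section \<open>Counting bicliques\<close>

text \<open>The quotient of the two binomials is a product of factors
  \<open>(d - i) / (M - i)\<close> with \<open>i < k\<close>, each at least
  \<open>(d - k) / M\<close>. The resulting pure power is what the convexity argument below
  needs.\<close>

lemma binomial_ratio_ge:
  assumes "k \<le> d" "d \<le> M"
  shows "real (M choose k) * ((real d - real k) / real M) ^ k \<le> real (d choose k)"
proof -
  have "real (M choose k) * ((real d - real k) / real M) ^ k
      = (\<Prod>i = 0..<k. real (M - i) / real (k - i) * ((real d - real k) / real M))"
    using assms by (simp add: binomial_altdef_of_nat prod.distrib prod_dividef power_divide)
  also have "\<dots> \<le> (\<Prod>i = 0..<k. real (d - i) / real (k - i))"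
  proof (rule prod_mono, safe)
    fix i assume i: "i \<in> {0..<k}"
    then have M: "real M > 0" using assms by auto
    show "0 \<le> real (M - i) / real (k - i) * ((real d - real k) / real M)"
      using assms by simp
    have "real (M - i) * ((real d - real k) / real M) \<le> real M * ((real d - real k) / real M)"
      using assms by (intro mult_right_mono) auto
    also have "\<dots> = real d - real k" using M by simp
    also have "\<dots> \<le> real (d - i)" using assms i by (auto simp: of_nat_diff)
    finally have "real (M - i) * ((real d - real k) / real M) / real (k - i)
        \<le> real (d - i) / real (k - i)"
      by (rule divide_right_mono) simp
    then show "real (M - i) / real (k - i) * ((real d - real k) / real M)
        \<le> real (d - i) / real (k - i)"
      by (simp add: mult.commute)
  qed
  also have "\<dots> = real (d choose k)"
    using assms by (simp add: binomial_altdef_of_nat)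
  finally show ?thesis .
qed

lemma ex_ge_average:
  fixes f :: "'a \<Rightarrow> real"
  assumes "finite J" "J \<noteq> {}" "real (card J) * c \<le> sum f J"
  obtains j where "j \<in> J" "c \<le> f j"
proof -
  have "\<exists>j\<in>J. c \<le> f j"
  proof (rule ccontr)
    assume "\<not> (\<exists>j\<in>J. c \<le> f j)"
    then have "sum f J < (\<Sum>j\<in>J. c)" using assms by (intro sum_strict_mono) auto
    with assms show False by simp
  qed
  then show ?thesis using that by blast
qed

text \<open>Jensen's inequality for \<open>x \<mapsto> x\<^sup>k\<close> enters through its tangent at the average, that is,
  through Bernoulli's inequality.\<close>

lemma ex_common_neighbourhood:
  fixes nb :: "'a \<Rightarrow> 'b set" and a :: real
  assumes "finite C" "finite T" "card T = M" "k \<le> M" "0 < a"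
    and nb: "\<And>v. v \<in> C \<Longrightarrow> nb v \<subseteq> T"
    and avg: "real (card C) * (a + real k) \<le> (\<Sum>v\<in>C. real (card (nb v)))"
  obtains T' where "T' \<subseteq> T" "card T' = k"
    "real (card C) * (a / real M) ^ k \<le> real (card {v \<in> C. T' \<subseteq> nb v})"
proof -
  define \<T> where "\<T> = {T'. T' \<subseteq> T \<and> card T' = k}"
  have fin: "finite \<T>" using assms by (simp add: \<T>_def)
  have card\<T>: "card \<T> = M choose k"
    using assms n_subsets[of T k] by (simp add: \<T>_def)
  \<comment> \<open>The lower bound of \<open>binomial_ratio_ge\<close> at degree
    \<open>a + k\<close>, the assumed average; each vertex is compared with the tangent
    there.\<close>
  define w where "w = real (M choose k) * (a / real M) ^ k"
  have w: "w \<ge> 0" using assms by (simp add: w_def)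
  have each: "w * (1 + real k * ((real (card (nb v)) - real k) / a - 1)) \<le> real (card (nb v) choose k)"
    if v: "v \<in> C" for v
  proof -
    define d where "d = card (nb v)"
    have dM: "d \<le> M" using card_mono[OF _ nb[OF v]] assms by (simp add: d_def)
    show ?thesis
    proof (cases "k \<le> d")
      case True
      have "1 + real k * ((real d - real k) / a - 1) \<le> (1 + ((real d - real k) / a - 1)) ^ k"
        using True assms by (intro Bernoulli_inequality) auto
      then have "w * (1 + real k * ((real d - real k) / a - 1)) \<le> w * ((real d - real k) / a) ^ k"
        using w by (intro mult_left_mono) auto
      also have "\<dots> = real (M choose k) * ((real d - real k) / real M) ^ k"
        using assms by (simp add: w_def power_divide)
      also have "\<dots> \<le> real (d choose k)"
        using True dM by (rule binomial_ratio_ge)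
      finally show ?thesis by (simp add: d_def)
    next
      \<comment> \<open>Here \<open>k\<close> is positive and the tangent is already nonpositive, so
        it lies below the binomial.\<close>
      case False
      then have "(real d - real k) / a \<le> 0" using assms by (simp add: divide_nonpos_pos)
      then have "real k * ((real d - real k) / a - 1) \<le> real k * (-1)"
        by (intro mult_left_mono) auto
      also have "\<dots> \<le> -1" using False by simp
      finally have "w * (1 + real k * ((real d - real k) / a - 1)) \<le> 0"
        using w by (simp add: mult_nonneg_nonpos)
      then show ?thesis unfolding d_def by linarith
    qed
  qed
  \<comment> \<open>The linear corrections add up to something nonnegative because the average
    degree is at least \<open>a + k\<close>.\<close>
  have "w * real (card C) \<le> w * (real (card C) + real k *
      (((\<Sum>v\<in>C. real (card (nb v))) - real (card C) * (a + real k)) / a))"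
    using w avg assms by (intro mult_left_mono) auto
  also have "\<dots> = (\<Sum>v\<in>C. w * (1 + real k * ((real (card (nb v)) - real k) / a - 1)))"
    using assms
    by (simp add: sum_distrib_left[symmetric] sum.distrib sum_subtractf sum_divide_distrib[symmetric] field_simps)
  also have "\<dots> \<le> (\<Sum>v\<in>C. real (card (nb v) choose k))"
    by (rule sum_mono) (rule each)
  also have "\<dots> = (\<Sum>v\<in>C. real (card {T' \<in> \<T>. T' \<subseteq> nb v}))"
  proof (rule sum.cong[OF refl])
    fix v assume v: "v \<in> C"
    have "{T' \<in> \<T>. T' \<subseteq> nb v} = {T'. T' \<subseteq> nb v \<and> card T' = k}"
      using nb[OF v] by (auto simp: \<T>_def)
    then show "real (card (nb v) choose k) = real (card {T' \<in> \<T>. T' \<subseteq> nb v})"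
      using n_subsets[of "nb v" k] nb[OF v] assms finite_subset by metis
  qed
  \<comment> \<open>Double counting of the pairs of a vertex \<open>v\<close> and a
    \<open>k\<close>-set inside its neighbourhood.\<close>
  also have "\<dots> = (\<Sum>v\<in>C. \<Sum>T'\<in>\<T>. if T' \<subseteq> nb v then 1 else 0)"
    using fin by (intro sum.cong) (auto simp: sum.If_cases Int_def)
  also have "\<dots> = (\<Sum>T'\<in>\<T>. \<Sum>v\<in>C. if T' \<subseteq> nb v then 1 else 0)"
    by (rule sum.swap)
  also have "\<dots> = (\<Sum>T'\<in>\<T>. real (card {v \<in> C. T' \<subseteq> nb v}))"
    using assms by (intro sum.cong) (auto simp: sum.If_cases Int_def)
  finally have "real (card \<T>) * (real (card C) * (a / real M) ^ k)
      \<le> (\<Sum>T'\<in>\<T>. real (card {v \<in> C. T' \<subseteq> nb v}))"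
    by (simp add: card\<T> w_def mult_ac)
  moreover have "\<T> \<noteq> {}"
    using card\<T> \<open>k \<le> M\<close> by (metis card.empty zero_less_binomial less_numeral_extra(3))
  ultimately obtain T' where "T' \<in> \<T>"
    "real (card C) * (a / real M) ^ k \<le> real (card {v \<in> C. T' \<subseteq> nb v})"
    using fin by (rule_tac ex_ge_average)
  then show ?thesis using that by (auto simp: \<T>_def)
qed

lemma sum_colour_degrees:
  fixes \<kappa> :: "'a \<Rightarrow> 'b \<Rightarrow> nat"
  assumes "finite C" "finite T" "\<And>v x. v \<in> C \<Longrightarrow> x \<in> T \<Longrightarrow> \<kappa> v x < q"
  shows "(\<Sum>j<q. \<Sum>v\<in>C. real (card {x \<in> T. \<kappa> v x = j})) = real (card C) * real (card T)"
proof -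
  have "(\<Sum>j<q. real (card {x \<in> T. \<kappa> v x = j})) = real (card T)" if "v \<in> C" for v
  proof -
    have "card (\<Union>j<q. {x \<in> T. \<kappa> v x = j}) = (\<Sum>j<q. card {x \<in> T. \<kappa> v x = j})"
      using assms by (intro card_UN_disjoint) auto
    moreover have "(\<Union>j<q. {x \<in> T. \<kappa> v x = j}) = T" using assms(3) that by auto
    ultimately show ?thesis by simp
  qed
  moreover have "(\<Sum>j<q. \<Sum>v\<in>C. real (card {x \<in> T. \<kappa> v x = j}))
      = (\<Sum>v\<in>C. \<Sum>j<q. real (card {x \<in> T. \<kappa> v x = j}))"
    by (rule sum.swap)
  ultimately show ?thesis by simp
qed

text \<open>Here \<open>p\<close> is the density of colour \<open>j\<close> after subtracting the
  loss \<open>s / M\<close> of the binomial estimate; some \<open>s\<close>-set is then joined in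
  colour \<open>j\<close> to a fraction \<open>p ^ s\<close> of \<open>C\<close>.\<close>

lemma ex_mono_biclique:
  fixes p :: real
  assumes "finite C" "finite T" "card T = M" "s \<le> M" "0 < M" "0 < p"
    and "real (card C) * (p * real M + real s) \<le> (\<Sum>v\<in>C. real (card {x \<in> T. \<kappa> v x = j}))"
    and "real k \<le> real (card C) * p ^ s"
  obtains S R where "S \<subseteq> T" "card S = s" "R \<subseteq> C" "card R = k"
    "\<And>v x. v \<in> R \<Longrightarrow> x \<in> S \<Longrightarrow> \<kappa> v x = j"
proof -
  obtain S where S: "S \<subseteq> T" "card S = s" and
    le: "real (card C) * (p * real M / real M) ^ s
      \<le> real (card {v \<in> C. S \<subseteq> {x \<in> T. \<kappa> v x = j}})"
    by (rule ex_common_neighbourhood[of C T M s "p * real M" "\<lambda>v. {x \<in> T. \<kappa> v x = j}"])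
      (use assms in auto)
  have "k \<le> card {v \<in> C. S \<subseteq> {x \<in> T. \<kappa> v x = j}}"
    using le assms(5,8) by simp
  then obtain R where "R \<subseteq> {v \<in> C. S \<subseteq> {x \<in> T. \<kappa> v x = j}}" "card R = k"
    by (meson obtain_subset_with_card_n)
  with S that[of S R] show ?thesis by auto
qed

text \<open>A majority colour has density at least \<open>1 / q\<close>. With
  \<open>2 * q * t\<^sup>2\<close> vertices in \<open>T\<close> the loss is a relative
  \<open>s / (2 * t\<^sup>2)\<close>, whose effect on the \<open>s\<close>-th power is at most a
  factor 2; the 2 in the size of \<open>C\<close> pays for it.\<close>

lemma ex_mono_biclique_majority:
  assumes "finite C" "finite T" "card T = 2 * q * t\<^sup>2" "card C = 2 * q ^ s * k"
    and "s \<le> t" "0 < t" "0 < q"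
    and col: "\<And>v x. v \<in> C \<Longrightarrow> x \<in> T \<Longrightarrow> \<kappa> v x < q"
  obtains j S R where "j < q" "S \<subseteq> T" "card S = s" "R \<subseteq> C" "card R = k"
    "\<And>v x. v \<in> R \<Longrightarrow> x \<in> S \<Longrightarrow> \<kappa> v x = j"
proof -
  let ?d = "\<lambda>j. \<Sum>v\<in>C. real (card {x \<in> T. \<kappa> v x = j})"
  obtain j where j: "j \<in> {..<q}" "real (card C) * (2 * real t ^ 2) \<le> ?d j"
    by (rule ex_ge_average[of "{..<q}" "real (card C) * (2 * real t ^ 2)" ?d])
      (use assms sum_colour_degrees[OF assms(1,2) col] in \<open>auto simp: mult_ac\<close>)
  \<comment> \<open>Chosen so that \<open>p\<close> times the size of \<open>T\<close>, plus
    \<open>s\<close>, is exactly \<open>2 * t\<^sup>2\<close>, the average degree of the majority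
    colour.\<close>
  define p where "p = (1 - real s / (2 * real t ^ 2)) / real q"
  have "1 \<le> t" using assms by simp
  then have "s \<le> t\<^sup>2" using \<open>s \<le> t\<close> by (metis le_trans power2_nat_le_imp_le self_le_power pos2 zero_less_one)
  then have st: "real s \<le> real t ^ 2" by (metis of_nat_le_iff of_nat_power)
  have t2: "real t ^ 2 > 0" using assms by simp
  have frac: "real s / (2 * real t ^ 2) \<le> 1 / 2" using st t2 by (simp add: field_simps)
  have "real s * (real s / (2 * real t ^ 2)) \<le> 1 / 2"
  proof -
    have "real s * real s \<le> real t * real t" using assms by (intro mult_mono) auto
    then show ?thesis using t2 by (simp add: field_simps power2_eq_square)
  qed
  also have "1 - real s * (real s / (2 * real t ^ 2)) \<le> (1 - real s / (2 * real t ^ 2)) ^ s"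
    using Bernoulli_inequality[of "- (real s / (2 * real t ^ 2))" s] frac by simp
  ultimately have half: "1 / 2 \<le> (1 - real s / (2 * real t ^ 2)) ^ s" by linarith
  show ?thesis
  proof (rule ex_mono_biclique[of C T "2 * q * t\<^sup>2" s p \<kappa> j k])
    show "s \<le> 2 * q * t\<^sup>2" using \<open>s \<le> t\<^sup>2\<close> \<open>0 < q\<close>
      by (metis (no_types) mult.commute le_trans mult_le_mono1 nat_mult_1 One_nat_def Suc_leI nat_0_less_mult_iff pos2)
    have "0 < 1 - real s / (2 * real t ^ 2)" using frac by linarith
    then show "0 < p" using assms by (simp add: p_def)
    have "p * real (2 * q * t\<^sup>2) + real s = 2 * real t ^ 2"
      using assms t2 by (simp add: p_def field_simps)
    with j show "real (card C) * (p * real (2 * q * t\<^sup>2) + real s)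
        \<le> (\<Sum>v\<in>C. real (card {x \<in> T. \<kappa> v x = j}))" by simp
    have "real k = 2 * real k * (1 / 2)" by simp
    also have "\<dots> \<le> 2 * real k * (1 - real s / (2 * real t ^ 2)) ^ s"
      using half by (intro mult_left_mono) auto
    also have "\<dots> = real (card C) * p ^ s"
      using assms by (simp add: p_def power_divide)
    finally show "real k \<le> real (card C) * p ^ s" .
  qed (use assms j that in auto)
qed

text \<open>If colour \<open>j0\<close> falls short of density \<open>(1 - \<eta>) / q\<close>, the
  deficit is shared by the other \<open>q - 1\<close> colours and raises one of them to
  \<open>(1 + \<eta> / (q - 1)) / q\<close>. The numbers \<open>pA\<close> and \<open>pB\<close> are
  these densities less the loss \<open>t / M\<close>.\<close>

lemma ex_mono_biclique_dichotomy:
  fixes \<eta> pA pB :: real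
  assumes "finite C" "finite T" "card T = M" "t \<le> M" "0 < M" "2 \<le> q" "j0 < q"
    and col: "\<And>v x. v \<in> C \<Longrightarrow> x \<in> T \<Longrightarrow> \<kappa> v x < q"
    and pA: "0 < pA" "pA * real M + real t = (1 - \<eta>) / real q * real M"
      "real r \<le> real (card C) * pA ^ t"
    and pB: "0 < pB" "pB * real M + real t = (1 + \<eta> / (real q - 1)) / real q * real M"
      "real t \<le> real (card C) * pB ^ t"
  obtains j S R where "S \<subseteq> T" "card S = t" "R \<subseteq> C" "j = j0 \<and> card R = r \<or> card R = t"
    "\<And>v x. v \<in> R \<Longrightarrow> x \<in> S \<Longrightarrow> \<kappa> v x = j"
proof -
  let ?d = "\<lambda>j. \<Sum>v\<in>C. real (card {x \<in> T. \<kappa> v x = j})"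
  let ?N = "real (card C)"
  show ?thesis
  proof (cases "?N * ((1 - \<eta>) / real q * real M) \<le> ?d j0")
    case True
    show ?thesis
      by (rule ex_mono_biclique[of C T M t pA \<kappa> j0 r]) (use assms True that[of _ _ j0] in auto)
  next
    case False
    let ?J = "{..<q} - {j0}"
    have "sum ?d {..<q} = ?d j0 + sum ?d ?J"
      using \<open>j0 < q\<close> by (subst sum.remove[of _ j0]) auto
    then have "?N * real M - ?N * ((1 - \<eta>) / real q * real M) \<le> sum ?d ?J"
      using False sum_colour_degrees[OF assms(1,2) col] assms(3) by simp
    moreover have "real (card ?J) = real q - 1"
      using assms by (simp add: of_nat_diff)
    moreover have "(real q - 1) * (?N * ((1 + \<eta> / (real q - 1)) / real q * real M))
        = ?N * real M - ?N * ((1 - \<eta>) / real q * real M)"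
    proof -
      have "(real q - 1) * ((1 + \<eta> / (real q - 1)) / real q) = 1 - (1 - \<eta>) / real q"
        using assms by (simp add: divide_simps)
      then have "(real q - 1) * ((1 + \<eta> / (real q - 1)) / real q) * (?N * real M)
        = (1 - (1 - \<eta>) / real q) * (?N * real M)" by simp
      then show ?thesis by (simp add: algebra_simps)
    qed
    moreover have "?J \<noteq> {}"
    proof -
      have "(if j0 = 0 then 1 else 0) \<in> ?J" using assms by auto
      then show ?thesis by blast
    qed
    ultimately obtain j where j: "j \<in> ?J"
      "?N * ((1 + \<eta> / (real q - 1)) / real q * real M) \<le> ?d j"
      using ex_ge_average[of ?J "?N * ((1 + \<eta> / (real q - 1)) / real q * real M)" ?d] by auto
    show ?thesis
      by (rule ex_mono_biclique[of C T M t pB \<kappa> j t]) (use assms j that[of _ _ j] in auto)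
  qed
qed

section \<open>The choice of parameters\<close>

text \<open>With \<open>x = w / t\<close>, \<open>ln (1 - x) \<ge> - x - 2 * x\<^sup>2\<close> and
  \<open>ln (1 + x) \<ge> x - x\<^sup>2\<close> for \<open>x\<close> up to 1/2. The hypothesis on
  \<open>w\<close> bounds the accumulated second-order error by 1, which is the 1 in the
  exponents.\<close>

lemma exp_le_one_plus_minus_power:
  fixes w :: real
  assumes "0 \<le> w" "2 * w\<^sup>2 \<le> real t" "4 \<le> t"
  shows "w / real t \<le> 1 / 2"
    and "exp (- w - 1) \<le> (1 - w / real t) ^ t"
    and "exp (w - 1) \<le> (1 + w / real t) ^ t"
proof -
  define x where "x = w / real t"
  have w: "w = real t * x" and x0: "0 \<le> x" using assms by (simp_all add: x_def)
  have "(2 * w)\<^sup>2 \<le> 4 * real t" using assms by (simp add: power_mult_distrib)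
  also have "\<dots> \<le> (real t)\<^sup>2" using assms by (simp add: power2_eq_square)
  finally have "2 * w \<le> real t" by (rule power2_le_imp_le) simp
  then have half: "x \<le> 1 / 2" using assms by (simp add: field_simps x_def)
  then show "w / real t \<le> 1 / 2" by (simp add: x_def)
  have t: "real t * (2 * x\<^sup>2) \<le> 1"
    using assms by (simp add: x_def power_divide power2_eq_square field_simps)
  have "real t * (- x - 2 * x\<^sup>2) \<le> real t * ln (1 - x)"
    using x0 half by (intro mult_left_mono ln_one_minus_pos_lower_bound) auto
  then have "exp (- w - 1) \<le> exp (real t * ln (1 - x))"
    using t by (simp add: w algebra_simps)
  also have "\<dots> = (1 - x) ^ t"
    using half by (simp add: exp_of_nat_mult)
  finally show "exp (- w - 1) \<le> (1 - w / real t) ^ t" by (simp add: x_def)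
  have "real t * (x - x\<^sup>2) \<le> real t * ln (1 + x)"
    using x0 half by (intro mult_left_mono ln_one_plus_pos_lower_bound) auto
  then have "exp (w - 1) \<le> exp (real t * ln (1 + x))"
    using t x0 by (simp add: w algebra_simps)
  also have "\<dots> = (1 + x) ^ t"
    using x0 by (simp add: exp_of_nat_mult)
  finally show "exp (w - 1) \<le> (1 + w / real t) ^ t" by (simp add: x_def)
qed

text \<open>For the fourth root \<open>u\<close> of \<open>t\<close>,
  \<open>ln u \<le> u / 2\<close> makes the left side at most \<open>25 / 2 * u\<^sup>2\<close>, and
  \<open>324 = 18\<^sup>2\<close> makes \<open>u\<^sup>2\<close> at least 18.\<close>

lemma ln_plus_half_square_le:
  assumes "324 \<le> t"
  shows "2 * (ln (real t) + 1 / 2)\<^sup>2 \<le> real t"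
proof -
  define u where "u = sqrt (sqrt (real t))"
  have u2: "u\<^sup>2 = sqrt (real t)" by (simp add: u_def)
  have "sqrt (18\<^sup>2) \<le> sqrt (real t)" using assms by (intro real_sqrt_le_mono) simp
  then have u18: "18 \<le> u\<^sup>2" by (simp add: u2)
  have t: "real t = u ^ 4"
  proof -
    have "u ^ 4 = (u\<^sup>2)\<^sup>2" by simp
    then show ?thesis by (simp only: u2) simp
  qed
  have "1\<^sup>2 \<le> u\<^sup>2" using u18 by simp
  then have u: "1 \<le> u" by (rule power2_le_imp_le) (simp add: u_def)
  have "ln (u / 2) \<le> u / 2 - 1" using u by (intro ln_le_minus_one) simp
  moreover have "ln (u / 2) = ln u - ln 2" using u by (simp add: ln_div)
  moreover have "ln 2 \<le> (1 :: real)" using ln_le_minus_one[of "2 :: real"] by simp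
  ultimately have "ln u \<le> u / 2" by linarith
  then have "ln (real t) + 1 / 2 \<le> 5 / 2 * u"
    using u by (simp add: t ln_realpow)
  then have "(ln (real t) + 1 / 2)\<^sup>2 \<le> (5 / 2 * u)\<^sup>2"
    using assms by (intro power_mono) auto
  then have "2 * (ln (real t) + 1 / 2)\<^sup>2 \<le> 25 / 2 * u\<^sup>2"
    by (simp add: power_mult_distrib power_divide)
  also have "\<dots> \<le> 18 * u\<^sup>2" by simp
  also have "\<dots> \<le> u\<^sup>2 * u\<^sup>2" using u18 by (intro mult_right_mono) auto
  finally show ?thesis by (simp add: t power4_eq_xxxx power2_eq_square mult_ac)
qed

text \<open>Equivalent to \<open>q \<le> t ^ q\<close>, which follows from
  \<open>q \<le> 2 ^ q\<close>.\<close>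

lemma log_ge_inverse:
  assumes "2 \<le> q" "2 \<le> t"
  shows "1 / real q \<le> log (real q) (real t)"
proof -
  have "real q \<le> 2 ^ q" using of_nat_less_two_power[of q] by (simp add: less_imp_le)
  then have "ln (real q) \<le> ln (2 ^ q)" using assms by (subst ln_le_cancel_iff) auto
  also have "\<dots> = real q * ln 2" by (simp add: ln_realpow)
  also have "\<dots> \<le> real q * ln (real t)"
    using assms by (intro mult_left_mono) auto
  finally show ?thesis using assms by (simp add: log_def field_simps)
qed

text \<open>All numerical work for the two-stage strategy: the densities fit the dichotomy, both of
  its counts succeed, and the total number of edges stays within the bound.\<close>

lemma two_stage_parameters:
  fixes q t :: nat
  assumes "2 \<le> q" "2 \<le> t" and large: "(9 * real q) ^ q < real t / log (real q) (real t)"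
  obtains r N :: nat and \<eta> pA pB :: real where
    "r \<le> t" "0 < pA" "0 < pB"
    "pA * real (2 * q * t\<^sup>2) + real t = (1 - \<eta>) / real q * real (2 * q * t\<^sup>2)"
    "pB * real (2 * q * t\<^sup>2) + real t = (1 + \<eta> / (real q - 1)) / real q * real (2 * q * t\<^sup>2)"
    "real r \<le> real N * pA ^ t" "real t \<le> real N * pB ^ t"
    "real (2 * q * t\<^sup>2 * (2 * q ^ (t - r) * (2 * q * t\<^sup>2)) + N * (2 * q * t\<^sup>2))
      \<le> 48 * real q ^ (t + 2) * real t ^ 2 *
        (real t * (real t / log (real q) (real t)) powr (- 1 / real q))"
proof -
  define Q where "Q = real q"
  define \<tau> where "\<tau> = real t"
  define L where "L = log (real q) (real t)"
  define z where "z = \<tau> / L"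
  have Q: "2 \<le> Q" and \<tau>2: "2 \<le> \<tau>" using assms by (simp_all add: Q_def \<tau>_def)
  have "1 / Q \<le> L" using log_ge_inverse[OF assms(1,2)] by (simp add: L_def Q_def)
  then have L0: "0 < L" and QL: "1 \<le> Q * L"
    using Q by (auto simp: field_simps intro: less_le_trans[of 0 "1 / Q" L])
  have zQ: "(9 * Q) ^ q < z" using large by (simp add: z_def L_def Q_def \<tau>_def)
  have "(9 * Q) ^ 2 \<le> (9 * Q) ^ q" using Q assms by (intro power_increasing) auto
  with zQ have z2: "(9 * Q) ^ 2 < z" by linarith
  have "(9 * 2) ^ 2 \<le> (9 * Q) ^ 2" using Q by (intro power_mono) auto
  with z2 have z324: "324 < z" by simp
  \<comment> \<open>This gives \<open>L \<ge> 1\<close>, hence \<open>z \<le> t\<close> and a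
    harmless rounding of \<open>2 * L\<close>.\<close>
  have "q < t"
  proof (rule ccontr)
    assume "\<not> q < t"
    then have "\<tau> \<le> Q" by (simp add: Q_def \<tau>_def)
    have "z \<le> Q * \<tau>"
    proof -
      have "\<tau> * 1 \<le> \<tau> * (Q * L)" using QL \<tau>2 by (intro mult_left_mono) auto
      then show ?thesis using L0 by (simp add: z_def field_simps)
    qed
    also have "\<dots> \<le> Q * Q" using \<open>\<tau> \<le> Q\<close> Q by (intro mult_left_mono) auto
    also have "\<dots> \<le> (9 * Q) ^ 2" by (simp add: power2_eq_square)
    finally show False using z2 by simp
  qed
  then have L1: "1 \<le> L" using assms by (simp add: L_def)
  have z\<tau>: "z \<le> \<tau>" using L1 \<tau>2 by (simp add: z_def field_simps)
  have Lz: "L = \<tau> / z" using L0 \<tau>2 by (simp add: z_def)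
  have t324: "324 \<le> t" using z324 z\<tau> by (simp add: \<tau>_def)
  define \<mu> where "\<mu> = ln z"
  have \<mu>\<tau>: "\<mu> \<le> ln \<tau>" using z324 z\<tau> by (simp add: \<mu>_def)
  have exp\<mu>: "exp \<mu> = z" using z324 by (simp add: \<mu>_def)
  have \<mu>Q: "1 \<le> \<mu> / Q"
  proof -
    have "exp 1 \<le> (9 * Q)" using exp_le Q by linarith
    then have "exp 1 ^ q \<le> (9 * Q) ^ q" by (intro power_mono) auto
    then have "exp Q \<le> exp \<mu>" using zQ exp\<mu> by (simp add: Q_def exp_of_nat_mult[symmetric])
    then show ?thesis using Q by simp
  qed
  \<comment> \<open>Up to the factor \<open>27 * q ^ t\<close>, the number of new vertices. Since
    \<open>N'\<close> is at least 1, it absorbs both the rounding of \<open>N\<close> and the cost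
    of the first stage.\<close>
  define N' where "N' = \<tau> * z powr (- 1 / Q)"
  have N'exp: "N' = \<tau> * exp (- \<mu> / Q)"
    using z324 by (simp add: N'_def powr_def \<mu>_def)
  have N'1: "1 \<le> N'"
  proof -
    have "\<mu> / Q \<le> \<mu> / 1" using \<mu>Q Q by (intro divide_left_mono) (auto simp: field_simps)
    then have "exp (\<mu> / Q) \<le> \<tau>" using z\<tau> exp\<mu> by (metis div_by_1 exp_le_cancel_iff order_trans)
    then show ?thesis by (simp add: N'exp exp_minus field_simps)
  qed
  \<comment> \<open>As \<open>q powr (2 * L) = t\<^sup>2\<close>, leaving \<open>r\<close> vertices
    to the second stage makes the first cheaper by a factor of at least
    \<open>t\<^sup>2\<close>.\<close>
  define r where "r = nat \<lceil>2 * L\<rceil>"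
  \<comment> \<open>The constant is \<open>27 = 3 * 9\<close>, with 3 from
    \<open>r \<le> 3 * L\<close> and 9 bounding \<open>exp (3 / 2)\<close>.\<close>
  define N where "N = nat \<lceil>27 * Q ^ t * N'\<rceil>"
  have r_le: "real r \<le> 3 * L" and r_ge: "2 * L \<le> real r"
    unfolding r_def using L1 by linarith+
  have "27 * Q ^ t * N' \<ge> 0" using Q N'1 by simp
  then have N_ge: "27 * Q ^ t * N' \<le> real N" and N_le: "real N \<le> 27 * Q ^ t * N' + 1"
    unfolding N_def by linarith+
  \<comment> \<open>Over \<open>t\<close> factors the density change multiplies the count by about
    \<open>z powr (1 / q - 1)\<close> for colour \<open>j0\<close> and \<open>z powr (1 / q)\<close>
    for another colour. Starting from \<open>N'\<close>, this leaves about \<open>t / z = L\<close>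
    and \<open>t\<close> vertices, the orders of \<open>r\<close> and \<open>t\<close>.\<close>
  define \<eta> where "\<eta> = (\<mu> - \<mu> / Q) / \<tau>"
  \<comment> \<open>The shifts by 1/2 in \<open>wA\<close> and \<open>wB\<close> are the loss
    \<open>t / M = 1 / (2 * q * t)\<close>, rescaled by \<open>q * t\<close>.\<close>
  define wA where "wA = \<mu> - \<mu> / Q + 1 / 2"
  define wB where "wB = \<mu> / Q - 1 / 2"
  define pA where "pA = (1 - wA / \<tau>) / Q"
  define pB where "pB = (1 + wB / \<tau>) / Q"
  have \<mu>0: "\<mu> / Q \<le> \<mu>" "0 \<le> \<mu>"
    using \<mu>Q Q by (auto simp: field_simps)
  have e3: "exp (3 / 2) \<le> (9 :: real)"
  proof -
    have "exp (3 / 2) \<le> exp (1 + 1 :: real)" by simp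
    also have "\<dots> = exp 1 * exp 1" by (rule exp_add)
    also have "\<dots> \<le> 3 * (3 :: real)" using exp_le by (intro mult_mono) auto
    finally show ?thesis by simp
  qed
  have w_square: "2 * w\<^sup>2 \<le> real t" if "0 \<le> w" "w \<le> ln \<tau> + 1 / 2" for w
  proof -
    have "w\<^sup>2 \<le> (ln \<tau> + 1 / 2)\<^sup>2" using that by (intro power_mono) auto
    then show ?thesis using ln_plus_half_square_le[OF t324] by (simp add: \<tau>_def)
  qed
  have wA: "0 \<le> wA" "wA \<le> ln \<tau> + 1 / 2"
    using \<mu>0 \<mu>\<tau> \<mu>Q unfolding wA_def by linarith+
  have wB: "0 \<le> wB" "wB \<le> ln \<tau> + 1 / 2"
    using \<mu>0 \<mu>\<tau> \<mu>Q unfolding wB_def by linarith+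
  have powA: "exp (- wA - 1) \<le> (1 - wA / \<tau>) ^ t" "wA / \<tau> \<le> 1 / 2"
    using exp_le_one_plus_minus_power[OF wA(1) w_square[OF wA]] t324 by (auto simp: \<tau>_def)
  have powB: "exp (wB - 1) \<le> (1 + wB / \<tau>) ^ t"
    using exp_le_one_plus_minus_power[OF wB(1) w_square[OF wB]] t324 by (auto simp: \<tau>_def)
  have stage2: "27 * N' * exp x \<le> real N * p ^ t"
    if "p = y / Q" "exp x \<le> y ^ t" for p x y
  proof -
    have "27 * N' * exp x \<le> 27 * N' * y ^ t" using that N'1 by (intro mult_left_mono) auto
    also have "\<dots> = 27 * Q ^ t * N' * p ^ t" using that Q by (simp add: power_divide)
    also have "\<dots> \<le> real N * p ^ t"
    proof (rule mult_right_mono[OF N_ge])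
      have "0 \<le> y ^ t" using that(2) exp_ge_zero[of x] by linarith
      then show "0 \<le> p ^ t" using that(1) Q by (simp add: power_divide)
    qed
    finally show ?thesis .
  qed
  \<comment> \<open>Both exponents fall short of the ideal by 3/2: 1/2 from the density loss and 1
    from replacing powers by exponentials.\<close>
  have loss: "3 * y \<le> 27 * y * exp (- 3 / 2)" if "0 \<le> y" for y :: real
    using mult_left_mono[OF e3 that] by (simp add: exp_minus field_simps)
  show ?thesis
  proof (rule that[of r pA pB \<eta> N])
    have "324 * L \<le> \<tau>" using z324 L0 by (simp add: z_def field_simps)
    then show "r \<le> t" using r_le L0 by (simp add: \<tau>_def)
    have "0 < 1 - wA / \<tau>" using powA(2) by linarith
    then show "0 < pA" using Q by (simp add: pA_def)
    show "0 < pB" using wB \<tau>2 Q by (auto simp: pB_def intro!: divide_pos_pos add_pos_nonneg)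
    show "pA * real (2 * q * t\<^sup>2) + real t = (1 - \<eta>) / real q * real (2 * q * t\<^sup>2)"
      using Q \<tau>2 by (simp add: pA_def \<eta>_def wA_def Q_def[symmetric] \<tau>_def[symmetric])
        (simp add: field_simps power2_eq_square)
    have "\<eta> / (Q - 1) = \<mu> / Q / \<tau>"
    proof -
      have "\<mu> - \<mu> / Q = (Q - 1) * (\<mu> / Q)" using Q by (simp add: field_simps)
      then show ?thesis using Q by (simp add: \<eta>_def)
    qed
    then show "pB * real (2 * q * t\<^sup>2) + real t
        = (1 + \<eta> / (real q - 1)) / real q * real (2 * q * t\<^sup>2)"
      using Q \<tau>2 by (simp add: pB_def wB_def Q_def[symmetric] \<tau>_def[symmetric])
        (simp add: field_simps power2_eq_square)
    have "real r \<le> 27 * L * exp (- 3 / 2)" using r_le loss[of L] L0 by linarith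
    also have "\<dots> = 27 * N' * exp (- wA - 1)"
    proof -
      have "exp (- \<mu> / Q) * exp (- wA - 1) = exp (- \<mu> + (- 3 / 2))"
        unfolding exp_add[symmetric] by (simp add: wA_def)
      also have "\<dots> = exp (- 3 / 2) / z" 
        using exp_diff[of "- 3 / 2" \<mu>] by (simp only: exp\<mu> add.commute diff_conv_add_uminus)
      finally have "27 * \<tau> * (exp (- \<mu> / Q) * exp (- wA - 1)) = 27 * \<tau> * (exp (- 3 / 2) / z)"
        by (rule arg_cong)
      then show ?thesis unfolding N'exp Lz by (simp only: mult.assoc times_divide_eq_left times_divide_eq_right)
    qed
    also have "\<dots> \<le> real N * pA ^ t" by (rule stage2[OF pA_def powA(1)])
    finally show "real r \<le> real N * pA ^ t" .
    have "real t \<le> 27 * \<tau> * exp (- 3 / 2)"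
      using loss[of \<tau>] \<tau>2 unfolding \<tau>_def by linarith
    also have "\<dots> = 27 * N' * exp (wB - 1)"
    proof -
      have "exp (- \<mu> / Q) * exp (wB - 1) = exp (- 3 / 2)"
        unfolding exp_add[symmetric] by (simp add: wB_def)
      then have "27 * \<tau> * (exp (- \<mu> / Q) * exp (wB - 1)) = 27 * \<tau> * exp (- 3 / 2)"
        by (rule arg_cong)
      then show ?thesis unfolding N'exp by (simp only: mult.assoc)
    qed
    also have "\<dots> \<le> real N * pB ^ t" by (rule stage2[OF pB_def powB])
    finally show "real t \<le> real N * pB ^ t" .
    \<comment> \<open>First-stage cost: the saving \<open>q ^ r \<ge> t\<^sup>2\<close> cancels the
      extra \<open>t\<^sup>2\<close> caused by asking for a set \<open>T\<close> of size
      \<open>2 * q * t\<^sup>2\<close>.\<close>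
    have "\<tau> = Q powr L" using assms by (simp add: L_def Q_def \<tau>_def)
    then have "\<tau> ^ 2 = Q powr (2 * L)"
      by (simp only: mult_2 powr_add power2_eq_square)
    also have "\<dots> \<le> Q powr real r" using r_ge Q by (intro powr_mono) auto
    also have "\<dots> = Q ^ r" using Q by (simp add: powr_realpow)
    finally have "Q ^ (t - r) * \<tau> ^ 2 \<le> Q ^ (t - r) * Q ^ r"
      using Q by (intro mult_left_mono) auto
    also have "\<dots> = Q ^ t" using \<open>r \<le> t\<close> by (simp add: power_add[symmetric])
    finally have "Q ^ (t - r) * \<tau> ^ 2 * (8 * Q ^ 2 * \<tau> ^ 2) \<le> Q ^ t * (8 * Q ^ 2 * \<tau> ^ 2)"
      by (rule mult_right_mono) simp
    also have "\<dots> = 8 * Q ^ (t + 2) * \<tau> ^ 2 * 1" by (simp add: power_add power2_eq_square)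
    also have "\<dots> \<le> 8 * Q ^ (t + 2) * \<tau> ^ 2 * N'" using N'1 Q by (intro mult_left_mono) auto
    finally have cost1: "Q ^ (t - r) * \<tau> ^ 2 * (8 * Q ^ 2 * \<tau> ^ 2) \<le> 8 * Q ^ (t + 2) * \<tau> ^ 2 * N'" .
    have "1 * 1 \<le> Q ^ t * N'" using Q N'1 by (intro mult_mono) (auto intro: one_le_power)
    then have "real N \<le> 28 * (Q ^ t * N')" using N_le by simp
    then have "real N * (2 * Q * \<tau> ^ 2) \<le> 28 * (Q ^ t * N') * (2 * Q * \<tau> ^ 2)"
      using Q by (intro mult_right_mono) auto
    also have "\<dots> = 28 * Q ^ (t + 1) * \<tau> ^ 2 * N' * 2" by (simp add: power_add)
    also have "\<dots> \<le> 28 * Q ^ (t + 1) * \<tau> ^ 2 * N' * Q" using Q N'1 by (intro mult_left_mono) auto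
    also have "\<dots> = 28 * Q ^ (t + 2) * \<tau> ^ 2 * N'" by (simp add: power_add power2_eq_square)
    finally have cost2: "real N * (2 * Q * \<tau> ^ 2) \<le> 28 * Q ^ (t + 2) * \<tau> ^ 2 * N'" .
    have "real (2 * q * t\<^sup>2 * (2 * q ^ (t - r) * (2 * q * t\<^sup>2)) + N * (2 * q * t\<^sup>2))
        = Q ^ (t - r) * \<tau> ^ 2 * (8 * Q ^ 2 * \<tau> ^ 2) + real N * (2 * Q * \<tau> ^ 2)"
      by (simp add: Q_def \<tau>_def power2_eq_square)
    also have "\<dots> \<le> 8 * Q ^ (t + 2) * \<tau> ^ 2 * N' + 28 * Q ^ (t + 2) * \<tau> ^ 2 * N'"
      using cost1 cost2 by (rule add_mono)
    also have "\<dots> = 36 * (Q ^ (t + 2) * \<tau> ^ 2 * N')" by simp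
    also have "\<dots> \<le> 48 * (Q ^ (t + 2) * \<tau> ^ 2 * N')" using Q N'1 by (intro mult_right_mono) auto
    finally show "real (2 * q * t\<^sup>2 * (2 * q ^ (t - r) * (2 * q * t\<^sup>2)) + N * (2 * q * t\<^sup>2))
      \<le> 48 * real q ^ (t + 2) * real t ^ 2 *
        (real t * (real t / log (real q) (real t)) powr (- 1 / real q))"
      by (simp add: Q_def \<tau>_def N'_def z_def L_def mult_ac)
  qed
qed

section \<open>Builder's strategies\<close>

lemma builder_can_win_one_stage:
  assumes "0 < q" "0 < t"
  shows "builder_can_win q (complete_bipartite t t) (2 * q * t\<^sup>2 * (2 * q ^ t * t))"
proof -
  define m where "m = 2 * q * t\<^sup>2"
  define n where "n = 2 * q ^ t * t"
  let ?A = "{..<m}" and ?B = "{m..<m + n}"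
  let ?P = "has_mono_copy (complete_bipartite t t)"
  have "forces q ?P [] (card ?A * card ?B + 0)"
  proof (rule forces_biclique)
    fix h \<kappa>
    assume \<kappa>: "\<And>a b. a \<in> ?A \<Longrightarrow> b \<in> ?B \<Longrightarrow> \<kappa> a b < q \<and> ({a, b}, \<kappa> a b) \<in> set h"
    obtain j S R where *: "S \<subseteq> ?A" "card S = t" "R \<subseteq> ?B" "card R = t"
      "\<And>b a. b \<in> R \<Longrightarrow> a \<in> S \<Longrightarrow> \<kappa> a b = j"
      by (rule ex_mono_biclique_majority[of ?B ?A q t t t "\<lambda>b a. \<kappa> a b"])
        (use assms \<kappa> in \<open>auto simp: m_def n_def\<close>)
    have "?P h"
    proof (rule has_mono_copy_complete_bipartite[of S t R j])
      show "({a, b}, j) \<in> set h" if "a \<in> S" "b \<in> R" for a b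
        using *(1,3) *(5)[OF that(2,1)] \<kappa>[of a b] that by blast
      show "finite S" "finite R" using *(1,3) finite_subset by blast+
      show "S \<inter> R = {}" using *(1,3) by fastforce
    qed (use * in auto)
    then show "forces q ?P h 0" by simp
  qed auto
  then show ?thesis
    by (intro builder_can_win_if_forces) (simp add: m_def n_def)
qed

text \<open>The set \<open>T\<close> found in the first stage serves as the large side of the
  second, so the \<open>t\<close> vertices chosen from it are already joined to all of
  \<open>S\<close> in colour \<open>j0\<close>.\<close>

lemma builder_can_win_two_stages:
  fixes \<eta> pA pB :: real
  assumes "2 \<le> q" "0 < t" "r \<le> t" and M: "M = 2 * q * t\<^sup>2"
    and pA: "0 < pA" "pA * real M + real t = (1 - \<eta>) / real q * real M"
      "real r \<le> real N * pA ^ t"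
    and pB: "0 < pB" "pB * real M + real t = (1 + \<eta> / (real q - 1)) / real q * real M"
      "real t \<le> real N * pB ^ t"
  shows "builder_can_win q (complete_bipartite t t) (M * (2 * q ^ (t - r) * M) + N * M)"
proof -
  define n where "n = 2 * q ^ (t - r) * M"
  let ?A = "{..<M}" and ?B = "{M..<M + n}" and ?C = "{M + n..<M + n + N}"
  let ?P = "has_mono_copy (complete_bipartite t t)"
  have "t * 1 \<le> t * (2 * q * t)" using assms by (intro mult_left_mono) auto
  then have tM: "t \<le> M" by (simp add: M power2_eq_square mult_ac)
  have "forces q ?P [] (card ?A * card ?B + N * M)"
  proof (rule forces_biclique)
    fix h \<kappa>
    assume old: "\<And>e. e \<in> fst ` set h \<Longrightarrow> e \<in> fst ` set [] \<or> e \<subseteq> ?A \<union> ?B"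
      and \<kappa>: "\<And>a b. a \<in> ?A \<Longrightarrow> b \<in> ?B \<Longrightarrow> \<kappa> a b < q \<and> ({a, b}, \<kappa> a b) \<in> set h"
    obtain j0 S T where *: "j0 < q" "S \<subseteq> ?A" "card S = t - r" "T \<subseteq> ?B" "card T = M"
      "\<And>b a. b \<in> T \<Longrightarrow> a \<in> S \<Longrightarrow> \<kappa> a b = j0"
      by (rule ex_mono_biclique_majority[of ?B ?A q t "t - r" M "\<lambda>b a. \<kappa> a b"])
        (use assms \<kappa> in \<open>auto simp: n_def\<close>)
    have fin: "finite S" "finite T" using *(2,4) finite_subset by blast+
    have "forces q ?P h (card ?C * card T + 0)"
    proof (rule forces_biclique)
      \<comment> \<open>First-stage edges lie inside \<open>?A \<union> ?B\<close>, so every edge at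
        a vertex of \<open>?C\<close> is still available.\<close>
      show "e \<inter> ?C = {}" if "e \<in> fst ` set h" for e
        using old[OF that] by fastforce
      show "?C \<inter> T = {}" using *(4) by fastforce
      fix h' \<kappa>'
      assume sub: "set h \<subseteq> set h'"
        and \<kappa>': "\<And>a b. a \<in> ?C \<Longrightarrow> b \<in> T \<Longrightarrow> \<kappa>' a b < q \<and> ({a, b}, \<kappa>' a b) \<in> set h'"
      obtain j U R where **: "U \<subseteq> T" "card U = t" "R \<subseteq> ?C" "j = j0 \<and> card R = r \<or> card R = t"
        "\<And>v x. v \<in> R \<Longrightarrow> x \<in> U \<Longrightarrow> \<kappa>' v x = j"
        by (rule ex_mono_biclique_dichotomy[of ?C T M t q j0 \<kappa>' pA \<eta> r pB])
          (use assms fin * tM \<kappa>' in auto)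
      have fin': "finite U" "finite R" using **(1,3) fin finite_subset by blast+
      have RU: "({v, x}, j) \<in> set h'" if "v \<in> R" "x \<in> U" for v x
        using **(1,3) **(5)[OF that] \<kappa>'[of v x] that by blast
      have disj: "R \<inter> U = {}" "S \<inter> U = {}" "S \<inter> R = {}"
        using **(1,3) *(2,4) by fastforce+
      have "?P h'"
      proof (cases "card R = t")
        case True
        then show ?thesis
          by (intro has_mono_copy_complete_bipartite[of R t U j]) (use ** fin' disj RU in auto)
      next
        case False
        then have j: "j = j0" "card R = r" using **(4) by auto
        have SU: "({a, x}, j) \<in> set h'" if "a \<in> S" "x \<in> U" for a x
        proof -
          have "a \<in> ?A" "x \<in> ?B" "x \<in> T" using that *(2,4) **(1) by blast+
          then show ?thesis using \<kappa>[of a x] *(6)[of x a] that(1) sub j by auto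
        qed
        \<comment> \<open>The \<open>t - r\<close> vertices of \<open>S\<close> and the
          \<open>r\<close> new ones form one side, \<open>U\<close> the other; all edges have colour
          \<open>j0\<close>.\<close>
        show ?thesis
        proof (rule has_mono_copy_complete_bipartite[of "S \<union> R" t U j])
          show "card (S \<union> R) = t"
            using fin fin' disj j *(3) \<open>r \<le> t\<close> by (simp add: card_Un_disjoint)
        qed (use ** fin fin' disj RU SU in auto)
      qed
      then show "forces q ?P h' 0" by simp
    qed (use fin in auto)
    then show "forces q ?P h (N * M)" using *(5) by simp
  qed auto
  then show ?thesis
    by (intro builder_can_win_if_forces) (simp add: n_def)
qed

lemma online_ramsey_le:
  assumes "builder_can_win q G N" "real N \<le> b"
  shows "ereal_of_enat (online_ramsey q G) \<le> ereal b"
proof -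
  have "online_ramsey q G \<le> enat N"
    unfolding online_ramsey_def using assms by (intro Inf_lower) auto
  then have "ereal_of_enat (online_ramsey q G) \<le> ereal_of_enat (enat N)"
    by (simp only: ereal_of_enat_le_iff)
  also have "\<dots> \<le> ereal b" using assms by simp
  finally show ?thesis .
qed

theorem theorem10:
  fixes q t :: nat
  assumes "q \<ge> 2" and "t \<ge> 2"
  shows "ereal_of_enat (online_ramsey q (complete_bipartite t t))
    \<le> ereal (48 * real q ^ (t + 2) * real t powr (3 - 1 / real q)
              * (log (real q) (real t)) powr (1 / real q))"
proof -
  define L where "L = log (real q) (real t)"
  define z where "z = real t / L"
  have L0: "0 < L" using assms by (simp add: L_def)
  have z0: "0 < z" using L0 assms by (simp add: z_def)
  let ?bound = "48 * real q ^ (t + 2) * real t ^ 2 * (real t * z powr (- 1 / real q))"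
  \<comment> \<open>The claimed bound depends on the logarithm only through \<open>z\<close>, as
    \<open>t ^ 3 * z powr (- 1 / q)\<close>.\<close>
  have "real t powr (3 - 1 / real q) * L powr (1 / real q)
      = real t ^ 3 * (L powr (1 / real q) / real t powr (1 / real q))"
    using assms by (simp add: powr_diff)
  also have "L powr (1 / real q) / real t powr (1 / real q) = z powr (- 1 / real q)"
    using L0 assms by (simp add: z_def powr_divide powr_minus_divide)
  also have "real t ^ 3 = real t ^ 2 * real t" by (simp add: power3_eq_cube power2_eq_square)
  finally have bound: "48 * real q ^ (t + 2) * real t powr (3 - 1 / real q) * L powr (1 / real q)
      = ?bound"
    by (simp add: mult.assoc)
  have "ereal_of_enat (online_ramsey q (complete_bipartite t t)) \<le> ereal ?bound"
  \<comment> \<open>Up to this threshold \<open>z powr (- 1 / q)\<close> is at least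
    \<open>1 / (9 * q)\<close>, so the one-stage cost \<open>4 * q ^ (t + 1) * t ^ 3\<close> fits,
    with 36 in place of 48; the two-stage estimate also needs only 36.\<close>
  proof (cases "z \<le> (9 * real q) ^ q")
    case True
    then have "z powr (1 / real q) \<le> ((9 * real q) ^ q) powr (1 / real q)"
      using z0 by (intro powr_mono2) auto
    also have "\<dots> = (9 * real q) powr (real q * (1 / real q))"
      using assms by (simp only: powr_powr[symmetric]) (subst powr_realpow, auto)
    also have "\<dots> = 9 * real q" using assms by simp
    finally have "1 / (9 * real q) \<le> 1 / z powr (1 / real q)"
      using z0 assms by (intro divide_left_mono) auto
    then have "1 / (9 * real q) \<le> z powr (- 1 / real q)"
      by (simp add: powr_minus_divide)
    then have "48 * real q ^ (t + 2) * real t ^ 2 * (real t * (1 / (9 * real q))) \<le> ?bound"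
      by (intro mult_left_mono) auto
    moreover have "real (2 * q * t\<^sup>2 * (2 * q ^ t * t))
        \<le> 48 * real q ^ (t + 2) * real t ^ 2 * (real t * (1 / (9 * real q)))"
      using assms by (simp add: power_add power2_eq_square)
    ultimately show ?thesis
      using assms by (intro online_ramsey_le[OF builder_can_win_one_stage]) auto
  next
    case False
    then have "(9 * real q) ^ q < real t / log (real q) (real t)" by (simp add: z_def L_def)
    from two_stage_parameters[OF assms this] obtain r N :: nat and \<eta> pA pB :: real where
      *: "r \<le> t" "0 < pA" "0 < pB"
      "pA * real (2 * q * t\<^sup>2) + real t = (1 - \<eta>) / real q * real (2 * q * t\<^sup>2)"
      "pB * real (2 * q * t\<^sup>2) + real t = (1 + \<eta> / (real q - 1)) / real q * real (2 * q * t\<^sup>2)"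
      "real r \<le> real N * pA ^ t" "real t \<le> real N * pB ^ t" and
      le: "real (2 * q * t\<^sup>2 * (2 * q ^ (t - r) * (2 * q * t\<^sup>2)) + N * (2 * q * t\<^sup>2)) \<le> ?bound"
      unfolding z_def L_def .
    have "0 < t" using assms by simp
    note builder_can_win_two_stages[where M = "2 * q * t\<^sup>2", OF assms(1) this *(1) refl *(2,4,6,3,5,7)]
    then show ?thesis using le by (rule online_ramsey_le)
  qed
  then show ?thesis unfolding bound[symmetric] by (simp add: L_def)
qed

end
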